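(* Let $S$ be a weak Gaussian semiring and let $B$ be a content $S$-semialgebra with content function $c$. Then the following statements hold for all natural numbers $n\ge 1$: (1) if $\operatorname{zd}(B)=n$, then $\operatorname{zd}(S)\le n$; (2) if $S$ is subtractive and has Property (A) and $\operatorname{zd}(S)=n$, then $\operatorname{zd}(B)=n$; (3) if $S$ is subtractive and the content function $c:B\to\operatorname{FId}(S)$ is onto, then $\operatorname{zd}(B)=n$ if and only if $\operatorname{zd}(S)=n$ and $S$ has Property (A).
   Context: A semiring $(S,+,\cdot,0,1)$ is commutative: $(S,+,0)$ and $(S,\cdot,1)$ are commutative monoids, $1\neq 0$, multiplication distributes over addition, and $s\cdot 0=0$ for all $s$. An ideal is a nonempty subset closed under addition and under multiplication by elements of $S$; $\operatorname{Id}(S)$ and $\operatorname{FId}(S)$ are the sets of ideals and of finitely generated ideals of $S$. A prime ideal is an ideal $P\neq S$ such that $ab\in P$ implies $a\in P$ or $b\in P$. An ideal $I$ is subtractive if $a+b\in I$ and $a\in I$ imply $b\in I$; $S$ is subtractive if all its ideals are. $S$ is weak Gaussian if for all $f,g\in S[X]$, $c(f)c(g)\subseteq\sqrt{c(fg)}$, where $c(f)$ for a polynomial $f$ is the ideal generated by its coefficients and $\sqrt I=\{s: s^k\in I\text{ for some positive integer }k\}$ (every subtractive semiring is weak Gaussian). $Z(S)$ is the set of zero-divisors: $s\in S$ with $ss'=0$ for some $s'\ne 0$ in $S$. $S$ has Property (A) if each finitely generated ideal $I\subseteq Z(S)$ has a nonzero annihilator, i.e. there is $s\ne 0$ in $S$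 with $sI=0$. For a semiring $R$, $\operatorname{zd}(R)=n$ means that $R$ has few zero-divisors of degree $n$: $Z(R)=\bigcup_{i=1}^n\mathbf{p}_i$ for prime ideals $\mathbf{p}_1,\ldots,\mathbf{p}_n$ of $R$ with $\mathbf{p}_i\nsubseteq\bigcup_{j\ne i}\mathbf{p}_j$ for all $i$ (for weak Gaussian $R$ these primes are uniquely determined and are the maximal primes of $Z(R)$); $\operatorname{zd}(R)\le n$ means $\operatorname{zd}(R)=k$ for some $k\le n$. An $S$-semialgebra is a semiring $B$ with a semiring homomorphism $\lambda:S\to B$ (preserving $+,\cdot,0,1$), with scalar product $sf=\lambda(s)f$; for an ideal $I$ of $S$, $IB=\{\sum_{i=1}^k a_if_i:a_i\in I,f_i\in B\}$. $B$ is a content $S$-semialgebra if $\lambda$ is injective (so $S\subseteq B$) and there is a function $c:B\to\operatorname{Id}(S)$ (the content function) such that: (i) for all $f\in B$ and all ideals $I$ of $S$, $f\in IB$ iff $c(f)\subseteq I$; (ii) $c(sf)=s\,c(f)$ for all $s\in S$, $f\in B$, and $c(1)=S$; (iii) for all $f,g\in B$ there is an integer $m\ge 0$ with $c(f)^{m+1}c(g)=c(f)^mc(fg)$. Products of ideals are sets of finite sums of products, and $I^0=S$. The values of $c$ are finitely generated ideals. *)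

theory Defs
  imports "HOL-Computational_Algebra.Polynomial"
begin

text \<open>
  Semirings are the types of class \<open>comm_semiring_1\<close>: both monoids are commutative, multiplication
  distributes over addition, \<open>0\<close> is absorbing and \<open>0 \<noteq> 1\<close>. Ideals are sets of elements.
\<close>

definition semiring_ideal :: "'a::comm_semiring_1 set \<Rightarrow> bool" where
  "semiring_ideal I \<longleftrightarrow> I \<noteq> {} \<and> (\<forall>a\<in>I. \<forall>b\<in>I. a + b \<in> I) \<and> (\<forall>s. \<forall>a\<in>I. s * a \<in> I)"

definition ideal_gen :: "'a::comm_semiring_1 set \<Rightarrow> 'a set" where
  "ideal_gen X = semiring_ideal hull X"

definition fg_ideals :: "'a::comm_semiring_1 set set" where
  "fg_ideals = {ideal_gen X | X. finite X}"

definition semiring_prime_ideal :: "'a::comm_semiring_1 set \<Rightarrow> bool" where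
  "semiring_prime_ideal P \<longleftrightarrow>
     semiring_ideal P \<and> P \<noteq> UNIV \<and> (\<forall>a b. a * b \<in> P \<longrightarrow> a \<in> P \<or> b \<in> P)"

definition subtractive_ideal :: "'a::comm_semiring_1 set \<Rightarrow> bool" where
  "subtractive_ideal I \<longleftrightarrow> semiring_ideal I \<and> (\<forall>a b. a + b \<in> I \<and> a \<in> I \<longrightarrow> b \<in> I)"

definition subtractive_semiring :: "'a::comm_semiring_1 itself \<Rightarrow> bool" where
  "subtractive_semiring _ \<longleftrightarrow> (\<forall>I :: 'a set. semiring_ideal I \<longrightarrow> subtractive_ideal I)"

definition ideal_prod :: "'a::comm_semiring_1 set \<Rightarrow> 'a set \<Rightarrow> 'a set" where
  "ideal_prod I J = {\<Sum>i<k. a i * b i | (k::nat) a b. \<forall>i<k. a i \<in> I \<and> b i \<in> J}"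

primrec ideal_power :: "'a::comm_semiring_1 set \<Rightarrow> nat \<Rightarrow> 'a set" where
  "ideal_power I 0 = UNIV"
| "ideal_power I (Suc m) = ideal_prod I (ideal_power I m)"

definition ideal_radical :: "'a::comm_semiring_1 set \<Rightarrow> 'a set" where
  "ideal_radical I = {s. \<exists>k>0. s ^ k \<in> I}"

text \<open>The ideal generated by the coefficients; not the library's gcd-based content.\<close>

definition poly_content :: "'a::comm_semiring_1 poly \<Rightarrow> 'a set" where
  "poly_content f = ideal_gen (range (coeff f))"

definition weak_gaussian :: "'a::comm_semiring_1 itself \<Rightarrow> bool" where
  "weak_gaussian _ \<longleftrightarrow> (\<forall>f g :: 'a poly.
     ideal_prod (poly_content f) (poly_content g) \<subseteq> ideal_radical (poly_content (f * g)))"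

definition zero_divisors :: "'a::comm_semiring_1 set" where
  "zero_divisors = {s. \<exists>s'. s' \<noteq> 0 \<and> s * s' = 0}"

definition property_A :: "'a::comm_semiring_1 itself \<Rightarrow> bool" where
  "property_A _ \<longleftrightarrow> (\<forall>I \<in> (fg_ideals :: 'a set set).
     I \<subseteq> zero_divisors \<longrightarrow> (\<exists>s. s \<noteq> 0 \<and> (\<forall>a\<in>I. s * a = 0)))"

text \<open>
  \<open>zd_eq TYPE('a) n\<close> stands for \<open>zd('a) = n\<close>. It is a relation because a semiring need not have
  few zero-divisors; it fails for \<open>n = 0\<close>, since \<open>0\<close> is a zero-divisor.
\<close>

definition zd_eq :: "'a::comm_semiring_1 itself \<Rightarrow> nat \<Rightarrow> bool" where
  "zd_eq _ n \<longleftrightarrow> (\<exists>p :: nat \<Rightarrow> 'a set.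
     (\<forall>i\<in>{1..n}. semiring_prime_ideal (p i)) \<and>
     zero_divisors = (\<Union>i\<in>{1..n}. p i) \<and>
     (\<forall>i\<in>{1..n}. \<not> p i \<subseteq> (\<Union>j\<in>{1..n} - {i}. p j)))"

definition zd_le :: "'a::comm_semiring_1 itself \<Rightarrow> nat \<Rightarrow> bool" where
  "zd_le T n \<longleftrightarrow> (\<exists>k\<le>n. zd_eq T k)"

definition semiring_hom :: "('a::comm_semiring_1 \<Rightarrow> 'b::comm_semiring_1) \<Rightarrow> bool" where
  "semiring_hom \<phi> \<longleftrightarrow> \<phi> 0 = 0 \<and> \<phi> 1 = 1 \<and>
     (\<forall>x y. \<phi> (x + y) = \<phi> x + \<phi> y) \<and> (\<forall>x y. \<phi> (x * y) = \<phi> x * \<phi> y)"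

text \<open>The extension \<open>IB\<close> of an ideal \<open>I\<close> along the structure map \<open>\<phi>\<close>.\<close>

definition ideal_ext :: "('a::comm_semiring_1 \<Rightarrow> 'b::comm_semiring_1) \<Rightarrow> 'a set \<Rightarrow> 'b set" where
  "ideal_ext \<phi> I = {\<Sum>i<k. \<phi> (a i) * f i | (k::nat) a f. \<forall>i<k. a i \<in> I}"

definition content_semialgebra ::
    "('a::comm_semiring_1 \<Rightarrow> 'b::comm_semiring_1) \<Rightarrow> ('b \<Rightarrow> 'a set) \<Rightarrow> bool" where
  "content_semialgebra \<phi> c \<longleftrightarrow>
     semiring_hom \<phi> \<and> inj \<phi> \<and>
     (\<forall>f. semiring_ideal (c f)) \<and>
     (\<forall>f I. semiring_ideal I \<longrightarrow> (f \<in> ideal_ext \<phi> I \<longleftrightarrow> c f \<subseteq> I)) \<and>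
     (\<forall>s f. c (\<phi> s * f) = (\<lambda>x. s * x) ` c f) \<and>
     c 1 = UNIV \<and>
     (\<forall>f g. \<exists>m. ideal_prod (ideal_power (c f) (m + 1)) (c g) =
                ideal_prod (ideal_power (c f) m) (c (f * g)))"

end

theory Submission imports Defs begin

text \<open>
  Everything rests on a McCoy-type description of the zero-divisors of a content semialgebra
  (\<open>zero_divisors_iff_content_annihilated\<close>): \<open>f\<close> is a zero-divisor of \<open>B\<close> exactly when a single
  nonzero scalar of \<open>S\<close> kills the whole content \<open>c f\<close>. Indeed, \<open>f g = 0\<close> and the
  Dedekind--Mertens relation (iii) give \<open>c(f)\<^sup>m\<^sup>+\<^sup>1 c(g) = 0\<close>, and one can strip the factors \<open>c(f)\<close>
  one at a time until a nonzero annihilator appears. In particular \<open>Z(S)\<close> is the contraction of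
  \<open>Z(B)\<close>, and \<open>c f \<subseteq> Z(S)\<close> for each zero-divisor \<open>f\<close>.

  Primes travel in both directions: they contract along \<open>\<phi>\<close>, and by the same relation (iii) a
  prime \<open>p\<close> of \<open>S\<close> extends to the prime \<open>pB = {f. c f \<subseteq> p}\<close> of \<open>B\<close>.

  (1) Contracting the primes that cover \<open>Z(B)\<close> yields primes that cover \<open>Z(S)\<close>; discarding
  superfluous ones leaves at most \<open>n\<close> of them.

  (2) When \<open>S\<close> is subtractive, prime avoidance holds in \<open>S\<close>. For a zero-divisor \<open>f\<close> the ideal
  \<open>c f\<close> is covered by the primes \<open>p\<^sub>i\<close> of \<open>Z(S)\<close>, so it lies in one of them and \<open>f \<in> p\<^sub>iB\<close>.
  Property (A), applied to the finitely generated ideal \<open>c f\<close>, gives the opposite inclusion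
  \<open>p\<^sub>iB \<subseteq> Z(B)\<close>.

  (3) If \<open>Z(B)\<close> is the irredundant union of primes \<open>Q\<^sub>i\<close>, then their contractions \<open>q\<^sub>i\<close> cover
  \<open>Z(S)\<close>. A finitely generated ideal inside \<open>Z(S)\<close> lies in some \<open>q\<^sub>i\<close> and is of the form \<open>c f\<close>;
  hence \<open>f \<in> q\<^sub>iB \<subseteq> Q\<^sub>i \<subseteq> Z(B)\<close>, and the McCoy property supplies the annihilator. No contraction is
  superfluous: otherwise \<open>q\<^sub>i \<subseteq> q\<^sub>j\<close> for some \<open>j \<noteq> i\<close> by prime avoidance in \<open>S\<close>, and since every
  zero-divisor lies in some \<open>q\<^sub>kB\<close>, the prime \<open>Q\<^sub>i\<close> would be covered by the others. This argument
  compares primes only inside \<open>S\<close> and so avoids prime avoidance in \<open>B\<close>, whose ideals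
  need not be subtractive.
\<close>

section \<open>Ideals of semirings\<close>

lemma semiring_ideal_zero: "semiring_ideal I \<Longrightarrow> 0 \<in> I"
  unfolding semiring_ideal_def by (metis ex_in_conv mult_zero_left)

lemma semiring_ideal_add: "semiring_ideal I \<Longrightarrow> a \<in> I \<Longrightarrow> b \<in> I \<Longrightarrow> a + b \<in> I"
  unfolding semiring_ideal_def by blast

lemma semiring_ideal_mult: "semiring_ideal I \<Longrightarrow> a \<in> I \<Longrightarrow> s * a \<in> I"
  unfolding semiring_ideal_def by blast

lemma semiring_ideal_sum:
  assumes "semiring_ideal I" "\<And>x. x \<in> A \<Longrightarrow> h x \<in> I"
  shows "sum h A \<in> I"
  using assms(2)
  by (induction A rule: infinite_finite_induct)
    (auto intro: semiring_ideal_zero semiring_ideal_add assms(1))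

lemma semiring_ideal_singleton_zero: "semiring_ideal {0}"
  unfolding semiring_ideal_def by simp

lemma semiring_ideal_ideal_gen: "semiring_ideal (ideal_gen X)"
  unfolding ideal_gen_def
proof (rule hull_in)
  fix T :: "'a set set"
  assume T: "Ball T semiring_ideal"
  then have "0 \<in> \<Inter>T"
    by (auto intro: semiring_ideal_zero)
  with T show "semiring_ideal (\<Inter>T)"
    unfolding semiring_ideal_def by blast
qed

lemma ideal_gen_minimal: "semiring_ideal I \<Longrightarrow> X \<subseteq> I \<Longrightarrow> ideal_gen X \<subseteq> I"
  unfolding ideal_gen_def by (rule hull_minimal)

lemma subset_ideal_gen: "X \<subseteq> ideal_gen X"
  unfolding ideal_gen_def by (rule hull_subset)

lemma semiring_ideal_fg_ideals: "I \<in> fg_ideals \<Longrightarrow> semiring_ideal I"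
  unfolding fg_ideals_def using semiring_ideal_ideal_gen by blast

lemma ideal_prod_memI: "x \<in> I \<Longrightarrow> y \<in> J \<Longrightarrow> x * y \<in> ideal_prod I J"
  unfolding ideal_prod_def
  by (simp, rule exI[of _ 1], rule exI[of _ "\<lambda>_. x"], rule exI[of _ "\<lambda>_. y"]) simp

lemma ideal_prod_subset_right:
  assumes "semiring_ideal K" "J \<subseteq> K"
  shows "ideal_prod I J \<subseteq> K"
  unfolding ideal_prod_def using assms
  by (auto intro!: semiring_ideal_sum semiring_ideal_mult)

lemma power_mem_ideal_power: "x \<in> I \<Longrightarrow> x ^ k \<in> ideal_power I k"
  by (induction k) (auto intro: ideal_prod_memI)

text \<open>
  If a power of \<open>I\<close> kills \<open>y \<noteq> 0\<close>, then the last power that does not kill \<open>y\<close> contains some \<open>z\<close>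
  with \<open>z y \<noteq> 0\<close>, and \<open>z y\<close> is annihilated by \<open>I\<close>.
\<close>

lemma annihilator_of_ideal_power:
  assumes "y \<noteq> 0" "\<forall>z \<in> ideal_power I k. z * y = 0"
  shows "\<exists>s. s \<noteq> 0 \<and> (\<forall>a\<in>I. s * a = 0)"
  using assms(2)
proof (induction k)
  case 0
  then have "1 * y = 0" by (simp del: mult_1)
  with assms(1) show ?case by simp
next
  case (Suc k)
  show ?case
  proof (cases "\<forall>z \<in> ideal_power I k. z * y = 0")
    case True
    then show ?thesis by (rule Suc.IH)
  next
    case False
    then obtain z where z: "z \<in> ideal_power I k" "z * y \<noteq> 0" by blast
    have "z * y * a = 0" if "a \<in> I" for a
    proof -
      have "a * z \<in> ideal_power I (Suc k)"
        using that z(1) by (simp add: ideal_prod_memI)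
      with Suc.prems have "a * z * y = 0" by blast
      then show ?thesis by (simp add: ac_simps)
    qed
    with z(2) show ?thesis by blast
  qed
qed

section \<open>Prime ideals, irredundant covers and prime avoidance\<close>

lemma prime_ideal_ideal: "semiring_prime_ideal P \<Longrightarrow> semiring_ideal P"
  unfolding semiring_prime_ideal_def by blast

lemma prime_ideal_multD:
  "semiring_prime_ideal P \<Longrightarrow> a * b \<in> P \<Longrightarrow> a \<in> P \<or> b \<in> P"
  unfolding semiring_prime_ideal_def by blast

lemma prime_ideal_one_notin:
  assumes "semiring_prime_ideal P"
  shows "1 \<notin> P"
proof
  assume "1 \<in> P"
  then have "s \<in> P" for s
    using semiring_ideal_mult[OF prime_ideal_ideal[OF assms], of 1 s] by simp
  with assms show False
    unfolding semiring_prime_ideal_def by blast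
qed

lemma prime_ideal_prodD:
  assumes "semiring_prime_ideal P"
  shows "finite A \<Longrightarrow> prod x A \<in> P \<Longrightarrow> \<exists>i\<in>A. x i \<in> P"
proof (induction A rule: finite_induct)
  case empty
  then show ?case using prime_ideal_one_notin[OF assms] by simp
next
  case (insert i A)
  then show ?case using prime_ideal_multD[OF assms, of "x i" "prod x A"] by auto
qed

lemma prime_ideal_powerD:
  assumes "semiring_prime_ideal P" "x ^ k \<in> P"
  shows "x \<in> P"
  using prime_ideal_prodD[OF assms(1), of "{..<k}" "\<lambda>_. x"] assms(2) by auto

lemma prime_ideal_vimage:
  assumes \<phi>: "semiring_hom \<phi>" and P: "semiring_prime_ideal P"
  shows "semiring_prime_ideal (\<phi> -` P)"
proof -
  have hom: "\<phi> 0 = 0" "\<phi> 1 = 1" "\<phi> (x + y) = \<phi> x + \<phi> y" "\<phi> (x * y) = \<phi> x * \<phi> y" for x y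
    using \<phi> unfolding semiring_hom_def by auto
  have "0 \<in> \<phi> -` P" "1 \<notin> \<phi> -` P"
    using semiring_ideal_zero[OF prime_ideal_ideal[OF P]] prime_ideal_one_notin[OF P]
    by (auto simp: hom)
  then have "\<phi> -` P \<noteq> {}" "\<phi> -` P \<noteq> UNIV" by blast+
  moreover have "semiring_ideal P" by (rule prime_ideal_ideal[OF P])
  ultimately show ?thesis
    unfolding semiring_prime_ideal_def semiring_ideal_def
    using prime_ideal_multD[OF P] by (simp add: hom)
qed

lemma irredundant_subcover:
  assumes "finite A"
  shows "\<exists>B\<subseteq>A. (\<Union>i\<in>B. p i) = (\<Union>i\<in>A. p i) \<and> (\<forall>i\<in>B. \<not> p i \<subseteq> (\<Union>j\<in>B - {i}. p j))"
  using assms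
proof (induction A rule: finite_psubset_induct)
  case (psubset A)
  show ?case
  proof (cases "\<forall>i\<in>A. \<not> p i \<subseteq> (\<Union>j\<in>A - {i}. p j)")
    case True
    then show ?thesis by blast
  next
    case False
    then obtain i where i: "i \<in> A" "p i \<subseteq> (\<Union>j\<in>A - {i}. p j)" by blast
    have "A - {i} \<subset> A" using i(1) by blast
    from psubset.IH[OF this] obtain B where B: "B \<subseteq> A - {i}"
      "(\<Union>j\<in>B. p j) = (\<Union>j\<in>A - {i}. p j)" "\<forall>i\<in>B. \<not> p i \<subseteq> (\<Union>j\<in>B - {i}. p j)"
      by (elim exE conjE)
    have "(\<Union>j\<in>A. p j) = (\<Union>j\<in>A - {i}. p j)" using i by blast
    with B(2) have "(\<Union>j\<in>B. p j) = (\<Union>j\<in>A. p j)" by (simp only:)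
    moreover have "B \<subseteq> A" using B(1) by blast
    ultimately show ?thesis using B(3) by (intro exI[of _ B] conjI)
  qed
qed

text \<open>
  In an irredundant cover each member \<open>p i\<close> has a point \<open>x i\<close> of \<open>I\<close> lying in no other member.
  The element \<open>x i\<^sub>0 + (\<Prod>i\<noteq>i\<^sub>0. x i)\<close> then escapes all members; subtractivity replaces the
  subtraction of the argument for rings.
\<close>

lemma prime_avoidance:
  assumes I: "semiring_ideal I" and A: "finite A"
    and prime: "\<And>i. i \<in> A \<Longrightarrow> semiring_prime_ideal (p i)"
    and sub: "\<And>i. i \<in> A \<Longrightarrow> subtractive_ideal (p i)"
    and cover: "I \<subseteq> (\<Union>i\<in>A. p i)"
  shows "\<exists>i\<in>A. I \<subseteq> p i"
proof -
  from irredundant_subcover[OF A, of "\<lambda>i. I \<inter> p i"] obtain B where B: "B \<subseteq> A"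
    "(\<Union>i\<in>B. I \<inter> p i) = (\<Union>i\<in>A. I \<inter> p i)"
    "\<forall>i\<in>B. \<not> I \<inter> p i \<subseteq> (\<Union>j\<in>B - {i}. I \<inter> p j)"
    by (elim exE conjE)
  have "I \<subseteq> (\<Union>i\<in>A. I \<inter> p i)" using cover by blast
  then have "I \<subseteq> (\<Union>i\<in>B. I \<inter> p i)" by (simp only: B(2))
  then have coverB: "I \<subseteq> (\<Union>i\<in>B. p i)" by blast
  have finB: "finite B" using A B(1) finite_subset by blast
  have "\<forall>i\<in>B. \<exists>x. x \<in> I \<and> x \<in> p i \<and> (\<forall>j\<in>B - {i}. x \<notin> p j)"
    using B(3) by blast
  then obtain x where x: "\<And>i. i \<in> B \<Longrightarrow> x i \<in> I" "\<And>i. i \<in> B \<Longrightarrow> x i \<in> p i"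
    "\<And>i j. i \<in> B \<Longrightarrow> j \<in> B \<Longrightarrow> j \<noteq> i \<Longrightarrow> x i \<notin> p j"
    by (metis Diff_iff singletonD)
  have "B \<noteq> {}" using coverB semiring_ideal_zero[OF I] by blast
  then obtain i where i: "i \<in> B" by blast
  show ?thesis
  proof (cases "B = {i}")
    case True
    then show ?thesis using coverB B(1) by blast
  next
    case False
    then obtain j where j: "j \<in> B - {i}" using i by blast
    define y where "y = prod x (B - {i})"
    have y_mem: "y \<in> J" if "semiring_ideal J" "k \<in> B - {i}" "x k \<in> J" for J k
    proof -
      have "y = prod x (B - {i} - {k}) * x k"
        unfolding y_def using finB that(2)
        by (subst prod.remove[of "B - {i}" k]) (auto simp: mult.commute)
      then show ?thesis using semiring_ideal_mult[OF that(1,3)] by simp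
    qed
    have "x i + y \<in> I"
      using x(1) i j y_mem[OF I j] by (intro semiring_ideal_add[OF I]) auto
    then obtain k where k: "k \<in> B" "x i + y \<in> p k" using coverB by blast
    have k': "subtractive_ideal (p k)" "semiring_prime_ideal (p k)"
      using k(1) B(1) sub prime by blast+
    have False
    proof (cases "k = i")
      case True
      then have "y \<in> p k"
        using k k' x(2) unfolding subtractive_ideal_def by blast
      then obtain l where "l \<in> B - {i}" "x l \<in> p k"
        unfolding y_def using prime_ideal_prodD[OF k'(2), of "B - {i}" x] finB by blast
      with x(3)[of l k] k(1) True show False by blast
    next
      case False
      then have "y \<in> p k"
        using y_mem[OF prime_ideal_ideal[OF k'(2)], of k] k(1) x(2) by blast
      then have "x i \<in> p k"
        using k(2) k'(1) unfolding subtractive_ideal_def by (metis add.commute)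
      with x(3)[of i k] i k(1) False show False by blast
    qed
    then show ?thesis ..
  qed
qed

lemma zd_leI:
  fixes p :: "nat \<Rightarrow> 'a::comm_semiring_1 set"
  assumes prime: "\<And>i. i \<in> {1..n} \<Longrightarrow> semiring_prime_ideal (p i)"
    and Z: "zero_divisors = (\<Union>i\<in>{1..n}. p i)"
  shows "zd_le TYPE('a) n"
proof -
  from irredundant_subcover[OF finite_atLeastAtMost, of 1 n p] obtain B where B: "B \<subseteq> {1..n}"
    "(\<Union>i\<in>B. p i) = (\<Union>i\<in>{1..n}. p i)" "\<forall>i\<in>B. \<not> p i \<subseteq> (\<Union>j\<in>B - {i}. p j)"
    by (elim exE conjE)
  have finB: "finite B" using B(1) finite_subset by blast
  then obtain h where h: "bij_betw h {1..card B} B"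
    using ex_bij_betw_nat_finite_1 by blast
  have im: "h ` {1..card B} = B" using h by (simp add: bij_betw_def)
  have im_diff: "h ` ({1..card B} - {i}) = B - {h i}" if "i \<in> {1..card B}" for i
  proof -
    have "h ` ({1..card B} - {i}) = h ` {1..card B} - h ` {i}"
      using that by (intro inj_on_image_set_diff[OF bij_betw_imp_inj_on[OF h]]) auto
    then show ?thesis unfolding im by simp
  qed
  have "zd_eq TYPE('a) (card B)"
    unfolding zd_eq_def
  proof (intro exI[of _ "p \<circ> h"] conjI ballI)
    fix i assume i: "i \<in> {1..card B}"
    then have hi: "h i \<in> B" using im by blast
    then show "semiring_prime_ideal ((p \<circ> h) i)" using prime B(1) by auto
    have "(\<Union>j\<in>{1..card B} - {i}. (p \<circ> h) j) = (\<Union>j\<in>B - {h i}. p j)"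
      unfolding im_diff[OF i, symmetric] by simp
    moreover have "\<not> p (h i) \<subseteq> (\<Union>j\<in>B - {h i}. p j)" by (rule bspec[OF B(3) hi])
    ultimately show "\<not> (p \<circ> h) i \<subseteq> (\<Union>j\<in>{1..card B} - {i}. (p \<circ> h) j)"
      by simp
  next
    have "(\<Union>i\<in>{1..card B}. (p \<circ> h) i) = (\<Union>i\<in>h ` {1..card B}. p i)" by simp
    then show "zero_divisors = (\<Union>i\<in>{1..card B}. (p \<circ> h) i)"
      unfolding im B(2) Z by simp
  qed
  moreover have "card B \<le> n" using card_mono[OF _ B(1)] by simp
  ultimately show ?thesis unfolding zd_le_def by blast
qed

section \<open>Contents and extensions of ideals\<close>

lemma ideal_ext_memI: "(\<And>i. i < (k::nat) \<Longrightarrow> a i \<in> I) \<Longrightarrow> (\<Sum>i<k. \<phi> (a i) * h i) \<in> ideal_ext \<phi> I"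
  unfolding ideal_ext_def
  by blast

lemma ideal_ext_memE:
  assumes "f \<in> ideal_ext \<phi> I"
  obtains k :: nat and a h where "f = (\<Sum>i<k. \<phi> (a i) * h i)" "\<And>i. i < k \<Longrightarrow> a i \<in> I"
  using assms unfolding ideal_ext_def by blast

lemma zero_mem_ideal_ext: "0 \<in> ideal_ext \<phi> I"
  using ideal_ext_memI[of 0 _ I \<phi>] by simp

lemma ideal_ext_add_generator:
  assumes "f \<in> ideal_ext \<phi> I" "a \<in> I"
  shows "f + \<phi> a * g \<in> ideal_ext \<phi> I"
proof -
  from assms(1) obtain k :: nat and b h
    where f: "f = (\<Sum>i<k. \<phi> (b i) * h i)" "\<And>i. i < k \<Longrightarrow> b i \<in> I"
    by (rule ideal_ext_memE) blast
  have "f + \<phi> a * g = (\<Sum>i<Suc k. \<phi> ((b(k := a)) i) * (h(k := g)) i)"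
    unfolding f(1) by simp
  also have "\<dots> \<in> ideal_ext \<phi> I"
    using f(2) assms(2) by (intro ideal_ext_memI) auto
  finally show ?thesis .
qed

lemma semiring_ideal_ideal_ext: "semiring_ideal (ideal_ext \<phi> I)"
  unfolding semiring_ideal_def
proof (intro conjI ballI allI)
  show "ideal_ext \<phi> I \<noteq> {}" using zero_mem_ideal_ext by blast
next
  fix f g assume f: "f \<in> ideal_ext \<phi> I" and "g \<in> ideal_ext \<phi> I"
  from this(2) obtain k :: nat and a h
    where g: "g = (\<Sum>i<k. \<phi> (a i) * h i)" "\<And>i. i < k \<Longrightarrow> a i \<in> I"
    by (rule ideal_ext_memE) blast
  have "l \<le> k \<Longrightarrow> f + (\<Sum>i<l. \<phi> (a i) * h i) \<in> ideal_ext \<phi> I" for l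
  proof (induction l)
    case 0
    then show ?case using f by simp
  next
    case (Suc l)
    then have "f + (\<Sum>i<l. \<phi> (a i) * h i) + \<phi> (a l) * h l \<in> ideal_ext \<phi> I"
      by (intro ideal_ext_add_generator g(2)) auto
    then show ?case by (simp add: add.assoc)
  qed
  then show "f + g \<in> ideal_ext \<phi> I" unfolding g(1) by simp
next
  fix s f assume "f \<in> ideal_ext \<phi> I"
  then obtain k :: nat and a h
    where f: "f = (\<Sum>i<k. \<phi> (a i) * h i)" "\<And>i. i < k \<Longrightarrow> a i \<in> I"
    by (rule ideal_ext_memE) blast
  have "s * f = (\<Sum>i<k. \<phi> (a i) * (s * h i))"
    unfolding f(1) by (simp add: sum_distrib_left ac_simps)
  also have "\<dots> \<in> ideal_ext \<phi> I"
    using f(2) by (rule ideal_ext_memI[where h = "\<lambda>i. s * h i"])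
  finally show "s * f \<in> ideal_ext \<phi> I" .
qed

lemma ideal_ext_subset:
  assumes "semiring_ideal Q" "I \<subseteq> \<phi> -` Q"
  shows "ideal_ext \<phi> I \<subseteq> Q"
proof
  fix f assume "f \<in> ideal_ext \<phi> I"
  then obtain k :: nat and a h
    where f: "f = (\<Sum>i<k. \<phi> (a i) * h i)" "\<And>i. i < k \<Longrightarrow> a i \<in> I"
    by (rule ideal_ext_memE) blast
  have "h i * \<phi> (a i) \<in> Q" if "i < k" for i
    using f(2)[OF that] assms(2) by (intro semiring_ideal_mult[OF assms(1)]) auto
  then show "f \<in> Q"
    unfolding f(1) by (intro semiring_ideal_sum[OF assms(1)]) (auto simp: mult.commute)
qed

locale content_semialg =
  fixes \<phi> :: "'a::comm_semiring_1 \<Rightarrow> 'b::comm_semiring_1"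
    and c :: "'b \<Rightarrow> 'a set"
  assumes content: "content_semialgebra \<phi> c"
begin

lemma hom: "semiring_hom \<phi>"
  using content unfolding content_semialgebra_def by blast

lemma hom_eq_zero_iff: "\<phi> s = 0 \<longleftrightarrow> s = 0"
  using content unfolding content_semialgebra_def semiring_hom_def by (metis injD)

lemma content_ideal: "semiring_ideal (c f)"
  using content unfolding content_semialgebra_def by blast

lemma mem_ideal_ext_iff: "semiring_ideal I \<Longrightarrow> f \<in> ideal_ext \<phi> I \<longleftrightarrow> c f \<subseteq> I"
  using content unfolding content_semialgebra_def by blast

lemma content_scale: "c (\<phi> s * f) = (\<lambda>x. s * x) ` c f"
  using content unfolding content_semialgebra_def by blast

lemma content_one: "c 1 = UNIV"
  using content unfolding content_semialgebra_def by blast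

lemma dedekind_mertens:
  "\<exists>m. ideal_prod (ideal_power (c f) (m + 1)) (c g) = ideal_prod (ideal_power (c f) m) (c (f * g))"
  using content unfolding content_semialgebra_def by blast

lemma content_hom: "c (\<phi> s) = range (\<lambda>x. s * x)"
  using content_scale[of s 1] by (simp add: content_one)

lemma content_subset_zero_iff: "c f \<subseteq> {0} \<longleftrightarrow> f = 0"
proof
  assume "c f \<subseteq> {0}"
  then have "f \<in> ideal_ext \<phi> {0}"
    by (simp add: mem_ideal_ext_iff semiring_ideal_singleton_zero)
  also have "ideal_ext \<phi> {0} \<subseteq> {0}"
    using hom by (intro ideal_ext_subset semiring_ideal_singleton_zero) (simp add: semiring_hom_def)
  finally show "f = 0" by simp
next
  assume "f = 0"
  then show "c f \<subseteq> {0}"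
    using mem_ideal_ext_iff[OF semiring_ideal_singleton_zero, of f] zero_mem_ideal_ext[of \<phi> "{0}"]
    by simp
qed

lemma content_hom_subset_iff:
  assumes "semiring_ideal I"
  shows "c (\<phi> s) \<subseteq> I \<longleftrightarrow> s \<in> I"
proof
  assume "c (\<phi> s) \<subseteq> I"
  moreover have "s * 1 \<in> c (\<phi> s)" unfolding content_hom by (rule rangeI)
  ultimately show "s \<in> I" by auto
next
  assume "s \<in> I"
  then have "x * s \<in> I" for x by (rule semiring_ideal_mult[OF assms])
  then show "c (\<phi> s) \<subseteq> I" unfolding content_hom by (auto simp: mult.commute)
qed

lemma mem_ideal_if_content_subset_vimage:
  assumes "semiring_ideal Q" "c f \<subseteq> \<phi> -` Q"
  shows "f \<in> Q"
proof -
  have "f \<in> ideal_ext \<phi> (c f)" by (simp add: mem_ideal_ext_iff content_ideal)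
  with ideal_ext_subset[OF assms] show ?thesis by blast
qed

text \<open>
  The scalars in a representation \<open>f = \<Sum> a\<^sub>i f\<^sub>i\<close> with \<open>a\<^sub>i \<in> c f\<close> generate an ideal whose extension
  already contains \<open>f\<close>, and \<open>c f\<close> is the smallest such ideal.
\<close>

lemma content_fg: "c f \<in> fg_ideals"
proof -
  have "f \<in> ideal_ext \<phi> (c f)" by (simp add: mem_ideal_ext_iff content_ideal)
  then obtain k :: nat and a h
    where f: "f = (\<Sum>i<k. \<phi> (a i) * h i)" "\<And>i. i < k \<Longrightarrow> a i \<in> c f"
    by (rule ideal_ext_memE) blast
  let ?J = "ideal_gen (a ` {..<k})"
  have "f \<in> ideal_ext \<phi> ?J"
    unfolding f(1) by (intro ideal_ext_memI subsetD[OF subset_ideal_gen]) simp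
  then have "c f \<subseteq> ?J" by (simp add: mem_ideal_ext_iff semiring_ideal_ideal_gen)
  moreover have "?J \<subseteq> c f" using f(2) by (intro ideal_gen_minimal content_ideal) blast
  ultimately have "c f = ?J" by (rule antisym)
  then show ?thesis unfolding fg_ideals_def by blast
qed

section \<open>Zero-divisors and primes in content semialgebras\<close>

theorem zero_divisors_iff_content_annihilated:
  "f \<in> zero_divisors \<longleftrightarrow> (\<exists>s. s \<noteq> 0 \<and> (\<forall>a\<in>c f. s * a = 0))"
proof
  assume "f \<in> zero_divisors"
  then obtain g where g: "g \<noteq> 0" "f * g = 0" unfolding zero_divisors_def by blast
  obtain m where m: "ideal_prod (ideal_power (c f) (m + 1)) (c g)
      = ideal_prod (ideal_power (c f) m) (c (f * g))"
    using dedekind_mertens by blast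
  have zero: "ideal_prod (ideal_power (c f) (m + 1)) (c g) \<subseteq> {0}"
    unfolding m using g(2) content_subset_zero_iff
    by (intro ideal_prod_subset_right semiring_ideal_singleton_zero) blast
  obtain y where y: "y \<in> c g" "y \<noteq> 0"
    using g(1) content_subset_zero_iff[of g] by blast
  have "\<forall>z \<in> ideal_power (c f) (m + 1). z * y = 0"
    using zero y(1) ideal_prod_memI by blast
  with y(2) show "\<exists>s. s \<noteq> 0 \<and> (\<forall>a\<in>c f. s * a = 0)" by (rule annihilator_of_ideal_power)
next
  assume "\<exists>s. s \<noteq> 0 \<and> (\<forall>a\<in>c f. s * a = 0)"
  then obtain s where s: "s \<noteq> 0" "\<forall>a\<in>c f. s * a = 0" by blast
  then have "c (\<phi> s * f) \<subseteq> {0}" unfolding content_scale by blast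
  then have "f * \<phi> s = 0" by (simp add: content_subset_zero_iff mult.commute)
  moreover have "\<phi> s \<noteq> 0" using s(1) by (simp add: hom_eq_zero_iff)
  ultimately show "f \<in> zero_divisors" unfolding zero_divisors_def by blast
qed

lemma content_subset_zero_divisors:
  "f \<in> zero_divisors \<Longrightarrow> c f \<subseteq> zero_divisors"
  unfolding zero_divisors_iff_content_annihilated
  unfolding zero_divisors_def by clarsimp (metis mult.commute)

lemma zero_divisors_vimage: "zero_divisors = \<phi> -` zero_divisors"
proof -
  have "\<phi> s \<in> zero_divisors \<longleftrightarrow> s \<in> zero_divisors" for s
  proof
    assume "\<phi> s \<in> zero_divisors"
    then have "c (\<phi> s) \<subseteq> zero_divisors" by (rule content_subset_zero_divisors)
    moreover have "s * 1 \<in> c (\<phi> s)" unfolding content_hom by (rule rangeI)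
    ultimately show "s \<in> zero_divisors" by auto
  next
    assume "s \<in> zero_divisors"
    then obtain t where t: "t \<noteq> 0" "s * t = 0" unfolding zero_divisors_def by blast
    then have "t * (s * x) = 0" for x by (metis mult.assoc mult.commute mult_zero_left)
    with t(1) show "\<phi> s \<in> zero_divisors"
      unfolding zero_divisors_iff_content_annihilated content_hom by blast
  qed
  then show ?thesis by blast
qed

text \<open>
  If \<open>x \<in> c f\<close> and \<open>y \<in> c g\<close> both avoid \<open>p\<close>, then so does \<open>x\<^sup>m\<^sup>+\<^sup>1 y\<close>; but by the Dedekind--Mertens
  relation this element lies in \<open>c (f g)\<close>.
\<close>

lemma prime_ideal_ext:
  assumes p: "semiring_prime_ideal p"
  shows "semiring_prime_ideal (ideal_ext \<phi> p)"
  unfolding semiring_prime_ideal_def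
proof (intro conjI allI impI)
  show "semiring_ideal (ideal_ext \<phi> p)" by (rule semiring_ideal_ideal_ext)
  note mem_iff = mem_ideal_ext_iff[OF prime_ideal_ideal[OF p]]
  have "1 \<notin> ideal_ext \<phi> p"
    unfolding mem_iff content_one using prime_ideal_one_notin[OF p] by blast
  then show "ideal_ext \<phi> p \<noteq> UNIV" by blast
  fix f g assume fg: "f * g \<in> ideal_ext \<phi> p"
  obtain m where m: "ideal_prod (ideal_power (c f) (m + 1)) (c g)
      = ideal_prod (ideal_power (c f) m) (c (f * g))"
    using dedekind_mertens by blast
  have sub: "ideal_prod (ideal_power (c f) (m + 1)) (c g) \<subseteq> p"
    unfolding m using fg mem_iff
    by (intro ideal_prod_subset_right prime_ideal_ideal[OF p]) blast
  have "x \<in> p \<or> y \<in> p" if "x \<in> c f" "y \<in> c g" for x y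
  proof -
    have "x ^ (m + 1) * y \<in> p"
      using sub ideal_prod_memI[OF power_mem_ideal_power[OF that(1)] that(2)] by blast
    then show ?thesis
      using prime_ideal_multD[OF p] prime_ideal_powerD[OF p] by blast
  qed
  then show "f \<in> ideal_ext \<phi> p \<or> g \<in> ideal_ext \<phi> p" unfolding mem_iff by blast
qed

section \<open>Transfer of few zero-divisors\<close>

lemma zd_le_if_zd_eq:
  assumes "zd_eq TYPE('b) n"
  shows "zd_le TYPE('a) n"
proof -
  from assms obtain Q :: "nat \<Rightarrow> 'b set" where Q: "\<forall>i\<in>{1..n}. semiring_prime_ideal (Q i)"
    "zero_divisors = (\<Union>i\<in>{1..n}. Q i)"
    unfolding zd_eq_def by blast
  show ?thesis
  proof (rule zd_leI)
    show "semiring_prime_ideal (\<phi> -` Q i)" if "i \<in> {1..n}" for i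
      using Q(1) that by (intro prime_ideal_vimage[OF hom]) blast
    show "zero_divisors = (\<Union>i\<in>{1..n}. \<phi> -` Q i)"
      by (subst zero_divisors_vimage) (simp add: Q(2) vimage_UN)
  qed
qed

lemma zd_eq_extend:
  assumes sub: "subtractive_semiring TYPE('a)" and A: "property_A TYPE('a)"
    and zd: "zd_eq TYPE('a) n"
  shows "zd_eq TYPE('b) n"
proof -
  from zd obtain p :: "nat \<Rightarrow> 'a set"
    where prime: "\<And>i. i \<in> {1..n} \<Longrightarrow> semiring_prime_ideal (p i)"
    and Z: "zero_divisors = (\<Union>i\<in>{1..n}. p i)"
    and irr: "\<And>i. i \<in> {1..n} \<Longrightarrow> \<not> p i \<subseteq> (\<Union>j\<in>{1..n} - {i}. p j)"
    unfolding zd_eq_def by meson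
  let ?P = "\<lambda>i. ideal_ext \<phi> (p i)"
  have mem_iff: "f \<in> ?P i \<longleftrightarrow> c f \<subseteq> p i" if "i \<in> {1..n}" for f i
    by (rule mem_ideal_ext_iff[OF prime_ideal_ideal[OF prime[OF that]]])
  show ?thesis
    unfolding zd_eq_def
  proof (intro exI[of _ ?P] conjI ballI)
    fix i assume i: "i \<in> {1..n}"
    then show "semiring_prime_ideal (?P i)" by (intro prime_ideal_ext prime)
    obtain s where s: "s \<in> p i" "\<And>j. j \<in> {1..n} - {i} \<Longrightarrow> s \<notin> p j"
      using irr[OF i] by blast
    have "\<phi> s \<in> ?P j \<longleftrightarrow> s \<in> p j" if "j \<in> {1..n}" for j
      using that by (simp only: mem_iff content_hom_subset_iff[OF prime_ideal_ideal[OF prime]])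
    with s i show "\<not> ?P i \<subseteq> (\<Union>j\<in>{1..n} - {i}. ?P j)" by blast
  next
    show "zero_divisors = (\<Union>i\<in>{1..n}. ?P i)"
    proof (intro equalityI subsetI)
      fix f :: 'b assume "f \<in> zero_divisors"
      then have "c f \<subseteq> (\<Union>i\<in>{1..n}. p i)" using content_subset_zero_divisors Z by blast
      then have "\<exists>i\<in>{1..n}. c f \<subseteq> p i"
        using sub prime prime_ideal_ideal unfolding subtractive_semiring_def
        by (intro prime_avoidance content_ideal) blast+
      then show "f \<in> (\<Union>i\<in>{1..n}. ?P i)" using mem_iff by blast
    next
      fix f assume "f \<in> (\<Union>i\<in>{1..n}. ?P i)"
      then have "c f \<subseteq> zero_divisors" using mem_iff Z by blast
      then show "f \<in> zero_divisors"
        using A content_fg unfolding property_A_def zero_divisors_iff_content_annihilated by blast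
    qed
  qed
qed

text \<open>
  The proof that no contraction \<open>\<phi> -` Q i\<close> is superfluous uses \<open>f \<in> Q k\<close> whenever
  \<open>c f \<subseteq> \<phi> -` Q k\<close>: an inclusion \<open>\<phi> -` Q i \<subseteq> \<phi> -` Q j\<close> in \<open>S\<close> then moves every element of \<open>Q i\<close>
  into a prime other than \<open>Q i\<close>.
\<close>

lemma zd_eq_contract:
  assumes sub: "subtractive_semiring TYPE('a)" and onto: "fg_ideals \<subseteq> range c"
    and zd: "zd_eq TYPE('b) n"
  shows "zd_eq TYPE('a) n" and "property_A TYPE('a)"
proof -
  from zd obtain Q :: "nat \<Rightarrow> 'b set"
    where prime: "\<And>i. i \<in> {1..n} \<Longrightarrow> semiring_prime_ideal (Q i)"
    and Z: "zero_divisors = (\<Union>i\<in>{1..n}. Q i)"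
    and irr: "\<And>i. i \<in> {1..n} \<Longrightarrow> \<not> Q i \<subseteq> (\<Union>j\<in>{1..n} - {i}. Q j)"
    unfolding zd_eq_def by meson
  let ?q = "\<lambda>i. \<phi> -` Q i"
  have q_prime: "semiring_prime_ideal (?q i)" if "i \<in> {1..n}" for i
    by (rule prime_ideal_vimage[OF hom prime[OF that]])
  have q_Z: "zero_divisors = (\<Union>i\<in>{1..n}. ?q i)"
    by (subst zero_divisors_vimage) (simp add: Z vimage_UN)
  have avoid: "\<exists>i\<in>A. I \<subseteq> ?q i"
    if "semiring_ideal I" "A \<subseteq> {1..n}" "I \<subseteq> (\<Union>i\<in>A. ?q i)" for I A
  proof (rule prime_avoidance[OF that(1) _ _ _ that(3)])
    show "finite A" using that(2) finite_subset by blast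
    show "semiring_prime_ideal (?q i)" "subtractive_ideal (?q i)" if "i \<in> A" for i
      using that \<open>A \<subseteq> {1..n}\<close> q_prime[of i] sub prime_ideal_ideal
      unfolding subtractive_semiring_def by blast+
  qed
  have mem_Q: "f \<in> Q i" if "i \<in> {1..n}" "c f \<subseteq> ?q i" for f i
    by (rule mem_ideal_if_content_subset_vimage[OF prime_ideal_ideal[OF prime[OF that(1)]] that(2)])
  show "property_A TYPE('a)"
    unfolding property_A_def
  proof (intro ballI impI)
    fix I :: "'a set" assume I: "I \<in> fg_ideals" and "I \<subseteq> zero_divisors"
    then obtain i where i: "i \<in> {1..n}" "I \<subseteq> ?q i"
      using avoid[OF semiring_ideal_fg_ideals[OF I], of "{1..n}"] q_Z by blast
    obtain f where f: "I = c f" using I onto by blast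
    have "f \<in> zero_divisors" using mem_Q[OF i(1)] i f Z by blast
    then show "\<exists>s. s \<noteq> 0 \<and> (\<forall>a\<in>I. s * a = 0)"
      unfolding zero_divisors_iff_content_annihilated f .
  qed
  show "zd_eq TYPE('a) n"
    unfolding zd_eq_def
  proof (intro exI[of _ ?q] conjI ballI)
    show "zero_divisors = (\<Union>i\<in>{1..n}. ?q i)" by (rule q_Z)
    fix i assume i: "i \<in> {1..n}"
    then show "semiring_prime_ideal (?q i)" by (rule q_prime)
    show "\<not> ?q i \<subseteq> (\<Union>j\<in>{1..n} - {i}. ?q j)"
    proof
      assume "?q i \<subseteq> (\<Union>j\<in>{1..n} - {i}. ?q j)"
      then obtain j where j: "j \<in> {1..n} - {i}" "?q i \<subseteq> ?q j"
        using avoid[OF prime_ideal_ideal[OF q_prime[OF i]], of "{1..n} - {i}"] by blast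
      have "Q i \<subseteq> (\<Union>j\<in>{1..n} - {i}. Q j)"
      proof
        fix f assume "f \<in> Q i"
        then have "c f \<subseteq> (\<Union>k\<in>{1..n}. ?q k)"
          using content_subset_zero_divisors Z i q_Z by blast
        then obtain k where k: "k \<in> {1..n}" "c f \<subseteq> ?q k"
          using avoid[OF content_ideal, of "{1..n}"] by blast
        (* prime avoidance may return k = i itself, which j then replaces *)
        show "f \<in> (\<Union>j\<in>{1..n} - {i}. Q j)"
        proof (cases "k = i")
          case True
          then have "f \<in> Q j" using mem_Q[of j] j k(2) by blast
          then show ?thesis using j(1) by blast
        next
          case False
          then show ?thesis using mem_Q[OF k] k(1) by blast
        qed
      qed
      with irr[OF i] show False by blast
    qed
  qed
qed

end

theorem theorem59:
  fixes \<phi> :: "'a::comm_semiring_1 \<Rightarrow> 'b::comm_semiring_1"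
    and c :: "'b \<Rightarrow> 'a set"
  assumes "weak_gaussian TYPE('a)"
    and "content_semialgebra \<phi> c"
  shows "\<forall>n\<ge>1.
     (zd_eq TYPE('b) n \<longrightarrow> zd_le TYPE('a) n) \<and>
     (subtractive_semiring TYPE('a) \<and> property_A TYPE('a) \<and> zd_eq TYPE('a) n
        \<longrightarrow> zd_eq TYPE('b) n) \<and>
     (subtractive_semiring TYPE('a) \<and> range c = fg_ideals
        \<longrightarrow> (zd_eq TYPE('b) n \<longleftrightarrow> zd_eq TYPE('a) n \<and> property_A TYPE('a)))"
proof -
  interpret content_semialg \<phi> c by standard (rule assms(2))
  show ?thesis
  proof (intro allI impI conjI)
    fix n
    show "zd_le TYPE('a) n" if "zd_eq TYPE('b) n"
      using that by (rule zd_le_if_zd_eq)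
    show "zd_eq TYPE('b) n"
      if "subtractive_semiring TYPE('a) \<and> property_A TYPE('a) \<and> zd_eq TYPE('a) n"
      using that by (elim conjE) (rule zd_eq_extend)
    show "zd_eq TYPE('b) n \<longleftrightarrow> zd_eq TYPE('a) n \<and> property_A TYPE('a)"
      if "subtractive_semiring TYPE('a) \<and> range c = fg_ideals"
    proof
      have sub: "subtractive_semiring TYPE('a)" and onto: "fg_ideals \<subseteq> range c"
        using that by simp_all
      show "zd_eq TYPE('a) n \<and> property_A TYPE('a)" if "zd_eq TYPE('b) n"
        using zd_eq_contract[OF sub onto that] by (rule conjI)
      show "zd_eq TYPE('b) n" if "zd_eq TYPE('a) n \<and> property_A TYPE('a)"
        using zd_eq_extend[OF sub] that by simp
    qed
  qed
qed

end
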